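(* Let $n\ge1$ and let $k_1,\dots,k_n$ be the numbers of column interpolation points in the variables $s_1,\dots,s_n$. The flop count of the recursive 1-D procedure (defined in the context) for computing a null vector of the $n$-D Loewner matrix $\mathbb L_n$ is $$\mathrm{flop}_1=\sum_{j=1}^n\Big(k_j^3\prod_{l=1}^{j}k_{l-1}\Big),\qquad k_0=1.$$
   Context: For a function $\mathcal H(s_1,\dots,s_n)$ evaluated at column points $\lambda^{(l)}_1,\dots,\lambda^{(l)}_{k_l}$ and row points $\mu^{(l)}_1,\dots,\mu^{(l)}_{k_l}$ ($l=1,\dots,n$), the $n$-D Loewner matrix has, in row $(i_1,\dots,i_n)$ and column $(j_1,\dots,j_n)$, the entry $\frac{\mathcal H(\mu^{(1)}_{i_1},\dots,\mu^{(n)}_{i_n})-\mathcal H(\lambda^{(1)}_{j_1},\dots,\lambda^{(n)}_{j_n})}{\prod_l(\mu^{(l)}_{i_l}-\lambda^{(l)}_{j_l})}$. A Loewner matrix with some variables frozen is the Loewner matrix of the function obtained by fixing those variables. Recursive procedure for a null vector in the variables $s_1,\dots,s_n$: (i) if $n=1$, compute a null vector of the $k_1\times k_1$ 1-D Loewner matrix; (ii) if $n\ge2$, compute a null vector of the single $k_1\times k_1$ 1-D Loewner matrix in $s_1$ with $s_2,\dots,s_n$ frozen at $\lambda^{(2)}_{k_2},\dots,\lambda^{(n)}_{k_n}$, and, for each of the $k_1$ values $s_1=\lambda^{(1)}_j$, compute (by the same procedure applied to the variables $s_2,\dots,s_n$) a null vector of the $(n-1)$-D Loewner matrix with $s_1$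 frozen at $\lambda^{(1)}_j$; these are then combined by scaling and stacking. Cost convention: computing a null vector of a $k\times k$ Loewner matrix costs $k^3$ flop; only these null space computations are counted (scaling and stacking are not counted). *)

theory Defs
  imports "Jordan_Normal_Form.Matrix_Kernel"
begin

text \<open>
  A function of \<open>n\<close> variables is a function on lists of length \<open>n\<close>. The column points are given
  as a list \<open>lam\<close> of \<open>n\<close> lists, the \<open>l\<close>-th one being the points of the \<open>l\<close>-th variable, and
  likewise the row points \<open>mu\<close>. Multi-indices are ordered lexicographically with the first
  variable most significant, as produced by \<open>product_lists\<close>.
\<close>

definition loewner_matrix ::
    "('a::field list \<Rightarrow> 'a) \<Rightarrow> 'a list list \<Rightarrow> 'a list list \<Rightarrow> 'a mat" where
  "loewner_matrix H lam mu =
     (let cols = product_lists lam; rows = product_lists mu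
      in mat (length rows) (length cols)
           (\<lambda>(i, j). (H (rows ! i) - H (cols ! j)) /
              (\<Prod>l<length lam. rows ! i ! l - cols ! j ! l)))"

text \<open>
  A null vector is a nonzero element of the kernel; a matrix with trivial kernel has none, and
  nothing is required of the routine in that case.
\<close>

definition null_vector_routine :: "('a::field mat \<Rightarrow> 'a vec) \<Rightarrow> bool" where
  "null_vector_routine ns \<longleftrightarrow>
     (\<forall>A v. v \<in> mat_kernel A \<and> v \<noteq> 0\<^sub>v (dim_col A) \<longrightarrow>
        ns A \<in> mat_kernel A \<and> ns A \<noteq> 0\<^sub>v (dim_col A))"

text \<open>
  A counted computation returns its result together with the number of flop spent. The cost is
  read off the matrix that is actually passed to the routine: \<open>k ^ 3\<close> if it is \<open>k \<times> k\<close>.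
\<close>

definition counted_null_vector ::
    "('a::field mat \<Rightarrow> 'a vec) \<Rightarrow> 'a mat \<Rightarrow> 'a vec \<times> nat" where
  "counted_null_vector ns A = (ns A, dim_col A ^ 3)"

text \<open>
  Each vector \<open>w\<^sub>j\<close> is normalised to have last entry 1, multiplied by the \<open>j\<close>-th entry of \<open>c\<close>,
  and the results are stacked. The last entry of \<open>w\<^sub>j\<close> belongs to the last column points of the
  remaining variables, which is where these are frozen in the matrix with null vector \<open>c\<close>.
\<close>

definition scale_and_stack :: "'a::field vec \<Rightarrow> 'a vec list \<Rightarrow> 'a vec" where
  "scale_and_stack c ws =
     vec_of_list (concat (map2 (\<lambda>a w. list_of_vec ((a / w $ (dim_vec w - 1)) \<cdot>\<^sub>v w))
       (list_of_vec c) ws))"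

text \<open>
  The last equation only makes the function total: it concerns \<open>n = 0\<close> and differing numbers of
  variables in the two lists of points.
\<close>

fun recursive_null_vector ::
    "('a::field mat \<Rightarrow> 'a vec) \<Rightarrow> ('a list \<Rightarrow> 'a) \<Rightarrow> 'a list list \<Rightarrow> 'a list list
      \<Rightarrow> 'a vec \<times> nat" where
  "recursive_null_vector ns H [lam1] [mu1] =
     counted_null_vector ns (loewner_matrix H [lam1] [mu1])"
| "recursive_null_vector ns H (lam1 # lam2 # lams) (mu1 # mu2 # mus) =
     (let (c, t) = counted_null_vector ns
            (loewner_matrix (\<lambda>s. H (s @ map last (lam2 # lams))) [lam1] [mu1]);
          rs = map (\<lambda>x. recursive_null_vector ns (\<lambda>s. H (x # s)) (lam2 # lams) (mu2 # mus)) lam1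
      in (scale_and_stack c (map fst rs), t + sum_list (map snd rs)))"
| "recursive_null_vector _ _ _ _ = undefined"

definition flop1 ::
    "('a::field mat \<Rightarrow> 'a vec) \<Rightarrow> ('a list \<Rightarrow> 'a) \<Rightarrow> 'a list list \<Rightarrow> 'a list list \<Rightarrow> nat" where
  "flop1 ns H lam mu = snd (recursive_null_vector ns H lam mu)"

end

theory Submission imports Defs begin

text \<open>The cost F satisfies F(k_1) = k_1^3 and F(k_1,...,k_n) = k_1^3 + k_1 F(k_2,...,k_n): one
  1-D matrix with k_1 columns, then one recursive call per column point of the first variable.
  Unrolling, k_j^3 is paid once for each choice of column points in the earlier variables, which
  gives the product. \<open>flop1_eq_sum_lengths\<close> solves this recurrence; the theorem only
  reindexes it.\<close>

lemma dim_col_loewner_matrix_single [simp]: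
  "dim_col (loewner_matrix H [xs] mu) = length xs"
  by (simp add: loewner_matrix_def Let_def length_product_lists)

lemma flop1_eq_sum_lengths:
  assumes "lam \<noteq> []" and "length mu = length lam"
  shows "flop1 ns H lam mu = (\<Sum>j<length lam. length (lam ! j) ^ 3 * (\<Prod>l<j. length (lam ! l)))"
  using assms
proof (induction lam arbitrary: H mu rule: list_nonempty_induct)
  case (single xs)
  then obtain ys where "mu = [ys]" by (auto simp: length_Suc_conv)
  then show ?case by (simp add: flop1_def counted_null_vector_def)
next
  case (cons xs lam)
  from cons.hyps obtain x2 lam' where lam: "lam = x2 # lam'" by (cases lam) auto
  with cons.prems obtain ys y2 mu' where mu: "mu = ys # y2 # mu'" "length (y2 # mu') = length lam"
    by (auto simp: length_Suc_conv)
  let ?S = "\<Sum>j<length lam. length (lam ! j) ^ 3 * (\<Prod>l<j. length (lam ! l))"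
  \<comment> \<open>\<open>?S\<close> does not depend on \<open>x\<close>: all recursive calls cost
    the same, so their sum is a multiple of \<open>?S\<close>.\<close>
  have IH: "snd (recursive_null_vector ns (\<lambda>s. H (x # s)) lam (y2 # mu')) = ?S" for x
    using cons.IH[OF mu(2)] by (simp add: flop1_def)
  have "flop1 ns H (xs # lam) mu = length xs ^ 3 + (\<Sum>x\<leftarrow>xs. ?S)"
    \<comment> \<open>Exposing the second variable lets the second equation of
      \<open>recursive_null_vector\<close> apply.\<close>
    using IH unfolding lam
    by (simp add: flop1_def counted_null_vector_def mu(1) o_def del: sum.lessThan_Suc)
  also have "\<dots> = length xs ^ 3 + length xs * ?S"
    by (simp add: sum_list_triv)
  also have "\<dots> = (\<Sum>j<length (xs # lam). length ((xs # lam) ! j) ^ 3 *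
      (\<Prod>l<j. length ((xs # lam) ! l)))"
    \<comment> \<open>The summand for j = 0 is the cube; each later product gives up its first
      factor, \<open>length xs\<close>.\<close>
    by (simp add: sum.lessThan_Suc_shift prod.lessThan_Suc_shift sum_distrib_left mult.left_commute
        del: sum.lessThan_Suc prod.lessThan_Suc)
  finally show ?case .
qed

theorem theorem5p5:
  fixes H :: "'a::field list \<Rightarrow> 'a"
    and ns :: "'a mat \<Rightarrow> 'a vec"
    and lam mu :: "'a list list"
    and n :: nat and k :: "nat \<Rightarrow> nat"
  assumes "n \<ge> 1"
    and "null_vector_routine ns"
    and "length lam = n" and "length mu = n"
    and "k 0 = 1"
    and "\<And>l. l \<in> {1..n} \<Longrightarrow> length (lam ! (l - 1)) = k l"
    and "\<And>l. l \<in> {1..n} \<Longrightarrow> length (mu ! (l - 1)) = k l"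
  shows "flop1 ns H lam mu = (\<Sum>j=1..n. k j ^ 3 * (\<Prod>l=1..j. k (l - 1)))"
proof -
  have len: "length (lam ! i) = k (Suc i)" if "i < n" for i
    using assms(6)[of "Suc i"] that by simp
  have "flop1 ns H lam mu = (\<Sum>j<n. length (lam ! j) ^ 3 * (\<Prod>l<j. length (lam ! l)))"
    using flop1_eq_sum_lengths[of lam mu ns H] assms(1,3,4) by fastforce
  also have "\<dots> = (\<Sum>j<n. k (Suc j) ^ 3 * (\<Prod>l<j. k (Suc l)))"
    by (intro sum.cong refl arg_cong2[where f = "(*)"] prod.cong) (simp_all add: len)
  \<comment> \<open>The convention \<open>k 0 = 1\<close> enters here: it supplies a leading factor
    1 to each product.\<close>
  also have "\<dots> = (\<Sum>j<n. k (Suc j) ^ 3 * (\<Prod>l<Suc j. k l))"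
    by (simp add: prod.lessThan_Suc_shift assms(5) del: prod.lessThan_Suc)
  also have "\<dots> = (\<Sum>j=1..n. k j ^ 3 * (\<Prod>l=1..j. k (l - 1)))"
    by (simp add: sum.atLeast1_atMost_eq prod.atLeast1_atMost_eq del: prod.lessThan_Suc)
  finally show ?thesis .
qed

end
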